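(* Let $k\ge 3$. The classes $\mathcal C_k$ and $\widetilde{\mathcal C_k}$ have unbounded lettericity; that is, for each of these two classes there is no constant bounding the lettericity of all graphs in the class.
   Context: All graphs are finite and simple. Lettericity: a decoder is a finite digraph $\mathcal D=(\Sigma,A)$ (loops allowed). For a word $w=w_1w_2\dots w_n$ over $\Sigma$, the letter graph $G(\mathcal D,w)$ has vertex set $\{1,\dots,n\}$, and for $i<j$ the pair $\{i,j\}$ is an edge if and only if $(w_i,w_j)\in A$. The lettericity of a graph $G$ is the smallest $|\Sigma|$ such that $G$ is isomorphic to $G(\mathcal D,w)$ for some decoder $\mathcal D$ on vertex set $\Sigma$ and some word $w$ over $\Sigma$. The graph $C_{k,l}$ has vertex set partitioned into $k$ independent sets (bags) $A_i=\{v_{i,1},\dots,v_{i,l}\}$, with $i$ modulo $k$; $v_{i,m}$ is adjacent to $v_{i+1,n}$ if and only if $m\le n$ (that is, $C_{k,l}$ is the union of $l$ cycles $v_{1,j},\dots,v_{k,j}$ together with the edges $v_{i,m}v_{i+1,n}$ for $m<n$), and there are no other edges. $\mathcal C_k$ is the class of all graphs $C_{k,l}$, $l\ge 1$, and their induced subgraphs (with the inherited partitions into bags). The chain circuit complement of a graph in $\mathcal C_k$ is obtained by complementing the adjacencies between $A_i$ and $A_{i+1}$ for all $i$ modulo $k$, leaving everything else unchanged; $\widetilde{\mathcal C_k}$ is the class of all chain circuit complements of graphs in $\mathcal C_k$. *)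

theory Defs
  imports Main
begin

type_synonym 'a ugraph = "'a set \<times> 'a set set"

abbreviation verts :: "'a ugraph \<Rightarrow> 'a set" where "verts \<equiv> fst"
abbreviation edges :: "'a ugraph \<Rightarrow> 'a set set" where "edges \<equiv> snd"

definition simple_graph :: "'a ugraph \<Rightarrow> bool" where
  "simple_graph G \<longleftrightarrow> finite (verts G) \<and> (\<forall>e\<in>edges G. e \<subseteq> verts G \<and> card e = 2)"

definition graph_iso :: "'a ugraph \<Rightarrow> 'b ugraph \<Rightarrow> bool" where
  "graph_iso G H \<longleftrightarrow> (\<exists>f. bij_betw f (verts G) (verts H) \<and>
     (\<forall>u\<in>verts G. \<forall>v\<in>verts G. {u, v} \<in> edges G \<longleftrightarrow> {f u, f v} \<in> edges H))"

definition induced_subgraph :: "'a ugraph \<Rightarrow> 'a set \<Rightarrow> 'a ugraph" where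
  "induced_subgraph G S = (S, {e \<in> edges G. e \<subseteq> S})"

text \<open>Positions in words are counted from 0.\<close>

definition letter_graph :: "('c \<times> 'c) set \<Rightarrow> 'c list \<Rightarrow> nat ugraph" where
  "letter_graph A w =
     ({..<length w}, {{i, j} |i j. i < j \<and> j < length w \<and> (w ! i, w ! j) \<in> A})"

text \<open>Letters are natural numbers; as alphabets are finite and only their size matters,
  this is no restriction.\<close>

definition has_letter_rep :: "'a ugraph \<Rightarrow> nat \<Rightarrow> bool" where
  "has_letter_rep G n \<longleftrightarrow> (\<exists>(\<Sigma>::nat set) A w. finite \<Sigma> \<and> card \<Sigma> = n \<and> A \<subseteq> \<Sigma> \<times> \<Sigma> \<and>
     set w \<subseteq> \<Sigma> \<and> graph_iso G (letter_graph A w))"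

definition lettericity :: "'a ugraph \<Rightarrow> nat" where
  "lettericity G = (LEAST n. has_letter_rep G n)"

definition unbounded_lettericity :: "'a ugraph set \<Rightarrow> bool" where
  "unbounded_lettericity \<G> \<longleftrightarrow> \<not> (\<exists>c. \<forall>G\<in>\<G>. lettericity G \<le> c)"

text \<open>The \<open>m\<close>-th vertex of bag \<open>i\<close> is the pair \<open>(i, m)\<close>, with bag index \<open>i \<in> {0..<k}\<close> taken modulo \<open>k\<close>.
  The bag of a vertex is thus its first component, also in induced subgraphs.\<close>

definition C_graph :: "nat \<Rightarrow> nat \<Rightarrow> (nat \<times> nat) ugraph" where
  "C_graph k l = ({0..<k} \<times> {1..l},
     {{(i, m), (Suc i mod k, n)} |i m n. i < k \<and> m \<in> {1..l} \<and> n \<in> {1..l} \<and> m \<le> n})"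

definition C_class :: "nat \<Rightarrow> (nat \<times> nat) ugraph set" where
  "C_class k = {induced_subgraph (C_graph k l) S |l S. l \<ge> 1 \<and> S \<subseteq> verts (C_graph k l)}"

definition consecutive_bags :: "nat \<Rightarrow> nat \<Rightarrow> nat \<Rightarrow> bool" where
  "consecutive_bags k i j \<longleftrightarrow> j = Suc i mod k \<or> i = Suc j mod k"

definition chain_circuit_complement :: "nat \<Rightarrow> ('a \<Rightarrow> nat) \<Rightarrow> 'a ugraph \<Rightarrow> 'a ugraph" where
  "chain_circuit_complement k bag G = (verts G,
     {{u, v} |u v. u \<in> verts G \<and> v \<in> verts G \<and> u \<noteq> v \<and>
        (if consecutive_bags k (bag u) (bag v) then {u, v} \<notin> edges G else {u, v} \<in> edges G)})"

definition C_compl_class :: "nat \<Rightarrow> (nat \<times> nat) ugraph set" where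
  "C_compl_class k = chain_circuit_complement k fst ` C_class k"

text \<open>Every finite simple graph has a letter representation (with one letter per vertex), so
  the minimum defining the lettericity exists; all graphs of the two classes are of this kind.\<close>

lemma has_letter_rep_card:
  assumes "simple_graph G"
  shows "has_letter_rep G (card (verts G))"
proof -
  let ?n = "card (verts G)"
  have fin: "finite (verts G)" using assms by (simp add: simple_graph_def)
  obtain f where f: "bij_betw f (verts G) {0..<?n}"
    using ex_bij_betw_finite_nat[OF fin] by blast
  define A where "A = {(i, j). i < ?n \<and> j < ?n \<and>
    {inv_into (verts G) f i, inv_into (verts G) f j} \<in> edges G}"
  have rng: "f u < ?n" if "u \<in> verts G" for u
    using bij_betwE[OF f] that by simp
  have A_iff: "(f u, f v) \<in> A \<longleftrightarrow> {u, v} \<in> edges G" if "u \<in> verts G" "v \<in> verts G" for u v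
    using that rng by (simp add: A_def bij_betw_inv_into_left[OF f])
  have ne: "u \<noteq> v" if "{u, v} \<in> edges G" for u v
  proof -
    have "card {u, v} = 2" using assms that by (simp add: simple_graph_def)
    then show ?thesis by auto
  qed
  have ed: "{i, j} \<in> edges (letter_graph A [0..<?n]) \<longleftrightarrow>
      (i < j \<and> j < ?n \<and> (i, j) \<in> A) \<or> (j < i \<and> i < ?n \<and> (j, i) \<in> A)" for i j
  proof -
    have "edges (letter_graph A [0..<?n]) = {{i, j} |i j. i < j \<and> j < ?n \<and> (i, j) \<in> A}"
      unfolding letter_graph_def by (simp cong: conj_cong)
    then show ?thesis by (simp add: doubleton_eq_iff) blast
  qed
  have "{u, v} \<in> edges G \<longleftrightarrow> {f u, f v} \<in> edges (letter_graph A [0..<?n])"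
    if uv: "u \<in> verts G" "v \<in> verts G" for u v
  proof -
    have "{u, v} \<in> edges G \<Longrightarrow> f u \<noteq> f v"
      using ne uv bij_betw_imp_inj_on[OF f] by (blast dest: inj_onD)
    moreover have "{v, u} = {u, v}" by blast
    ultimately show ?thesis
      unfolding ed A_iff[OF uv] A_iff[OF uv(2) uv(1)] using rng[OF uv(1)] rng[OF uv(2)] by auto
  qed
  moreover have "verts (letter_graph A [0..<?n]) = {0..<?n}"
    by (auto simp: letter_graph_def)
  ultimately have "graph_iso G (letter_graph A [0..<?n])"
    unfolding graph_iso_def using f by auto
  moreover have "A \<subseteq> {0..<?n} \<times> {0..<?n}" by (auto simp: A_def)
  ultimately show ?thesis
    unfolding has_letter_rep_def
    by (intro exI[of _ "{0..<?n}"] exI[of _ A] exI[of _ "[0..<?n]"]) simp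
qed

lemma simple_graph_C_class:
  assumes "k \<ge> 2" and "G \<in> C_class k"
  shows "simple_graph G"
proof -
  have ne: "i \<noteq> Suc i mod k" if "i < k" for i
    using that assms(1) by (cases "Suc i = k") auto
  obtain l S where G: "G = induced_subgraph (C_graph k l) S" and S: "S \<subseteq> {0..<k} \<times> {1..l}"
    using assms(2) by (auto simp: C_class_def C_graph_def)
  have "finite S" using S by (rule finite_subset) simp
  moreover have "card e = 2" if e: "e \<in> edges G" for e
  proof -
    obtain i m n where "i < k" "e = {(i, m), (Suc i mod k, n)}"
      using e by (auto simp: G induced_subgraph_def C_graph_def)
    then show ?thesis using ne[of i] by simp
  qed
  ultimately show ?thesis
    by (auto simp: simple_graph_def G induced_subgraph_def)
qed

lemma simple_graph_C_compl_class:
  assumes "k \<ge> 2" and "G \<in> C_compl_class k"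
  shows "simple_graph G"
proof -
  obtain H where "H \<in> C_class k" and G: "G = chain_circuit_complement k fst H"
    using assms(2) by (auto simp: C_compl_class_def)
  then have "finite (verts H)"
    using simple_graph_C_class[OF assms(1)] by (simp add: simple_graph_def)
  then show ?thesis
    by (auto simp: G simple_graph_def chain_circuit_complement_def)
qed

end

theory Submission
  imports Defs "HOL-Library.FuncSet"
begin

text \<open>
  Why the lettericity is unbounded. Fix a letter representation of a graph on bags
  \<open>0, \<dots>, k - 1\<close> in which, for all \<open>m\<close> and \<open>n\<close>, the vertices \<open>(i, m)\<close> and \<open>(i + 1, n)\<close> are
  adjacent iff \<open>m \<le> n\<close> (or, for the chain circuit complement, iff \<open>m > n\<close>), with bag indices
  modulo \<open>k\<close>. If there are more than \<open>c ^ k\<close> columns and only \<open>c\<close> letters, then two columns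
  \<open>m < n\<close> carry the same letter in every bag. In two cyclically consecutive bags these columns
  have four vertices, and the two in the same bag share their letter, so adjacency between the
  bags depends only on whether the vertex of bag \<open>i\<close> or that of bag \<open>i + 1\<close> comes first in the
  word. This forces the order of the four positions to be either
  \<open>(i, m), (i + 1, m), (i, n), (i + 1, n)\<close> or its exact reversal (\<open>two_column_order\<close>).
  Which of the two occurs is visible in bag \<open>i\<close> alone and also in bag \<open>i + 1\<close> alone, so the choice
  is the same all around the circuit. The positions of \<open>(0, m), (1, m), \<dots>, (k - 1, m), (0, m)\<close>
  are then strictly monotone, which is absurd. Hence a representation of \<open>l\<close> columns by \<open>c\<close>
  letters has \<open>l \<le> c ^ k\<close> (\<open>columns_le_letters_power\<close>).
\<close>

lemma cyclic_not_strictly_monotone: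
  fixes g :: "nat \<Rightarrow> 'a::linorder"
  assumes "k > 0"
  shows "\<exists>i<k. g (Suc i mod k) \<le> g i" and "\<exists>i<k. g i \<le> g (Suc i mod k)"
proof -
  have fin: "finite (g ` {..<k})" and ne: "g ` {..<k} \<noteq> {}" using assms by auto
  have succ: "g (Suc i mod k) \<in> g ` {..<k}" for i using assms by simp
  obtain i where "i < k" "g i = Max (g ` {..<k})"
    using Max_in[OF fin ne] by auto
  then show "\<exists>i<k. g (Suc i mod k) \<le> g i" using Max_ge[OF fin succ] by metis
  obtain j where "j < k" "g j = Min (g ` {..<k})"
    using Min_in[OF fin ne] by auto
  then show "\<exists>i<k. g i \<le> g (Suc i mod k)" using Min_le[OF fin succ] by metis
qed

lemma Suc_mod_neq:
  assumes "k \<ge> 2" "i < k"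
  shows "Suc i mod k \<noteq> i"
  using assms by (cases "Suc i = k") auto

lemma Suc_Suc_mod_neq:
  assumes "k \<ge> 3" "i < k"
  shows "Suc (Suc i mod k) mod k \<noteq> i"
proof (cases "Suc i = k")
  case True
  then show ?thesis using assms by simp
next
  case False
  then show ?thesis using assms by (cases "Suc (Suc i) = k") auto
qed

text \<open>A letter representation as a position and a letter for each vertex.\<close>

lemma has_letter_repE:
  assumes "has_letter_rep G c"
  obtains \<Sigma> :: "nat set" and A and pos :: "'a \<Rightarrow> nat" and letter :: "'a \<Rightarrow> nat"
  where "finite \<Sigma>" "card \<Sigma> = c" "inj_on pos (verts G)" "letter ` verts G \<subseteq> \<Sigma>"
    and "\<And>u v. u \<in> verts G \<Longrightarrow> v \<in> verts G \<Longrightarrow> pos u < pos v \<Longrightarrow>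
      {u, v} \<in> edges G \<longleftrightarrow> (letter u, letter v) \<in> A"
proof -
  obtain \<Sigma> :: "nat set" and A w f where \<Sigma>: "finite \<Sigma>" "card \<Sigma> = c" "set w \<subseteq> \<Sigma>"
    and f: "bij_betw f (verts G) (verts (letter_graph A w))"
    and iso: "\<forall>u\<in>verts G. \<forall>v\<in>verts G. {u, v} \<in> edges G \<longleftrightarrow> {f u, f v} \<in> edges (letter_graph A w)"
    using assms unfolding has_letter_rep_def graph_iso_def by blast
  have len: "f u < length w" if "u \<in> verts G" for u
    using bij_betwE[OF f] that by (auto simp: letter_graph_def)
  have edge: "{i, j} \<in> edges (letter_graph A w) \<longleftrightarrow> (w ! i, w ! j) \<in> A"
    if "i < j" "j < length w" for i j
    using that by (auto simp: letter_graph_def doubleton_eq_iff)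
  show thesis
  proof (rule that[of \<Sigma> f "\<lambda>u. w ! f u" A])
    show "inj_on f (verts G)" using f by (rule bij_betw_imp_inj_on)
    show "(\<lambda>u. w ! f u) ` verts G \<subseteq> \<Sigma>" using len \<Sigma>(3) by force
    show "{u, v} \<in> edges G \<longleftrightarrow> (w ! f u, w ! f v) \<in> A"
      if "u \<in> verts G" "v \<in> verts G" "f u < f v" for u v
      using iso that edge len by blast
  qed (use \<Sigma> in auto)
qed

text \<open>
  The positions \<open>x\<close>, \<open>y\<close> belong to the first and second column in one bag and \<open>x'\<close>, \<open>y'\<close> to
  the same columns in the next bag. The Boolean \<open>P\<close> says whether a vertex of the first bag placed
  before one of the second bag is adjacent to it, and \<open>Q\<close> is its analogue for the opposite order;
  \<open>b\<close> is \<open>True\<close> for the chain circuit and \<open>False\<close> for its complement.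
\<close>

lemma two_column_order:
  fixes x x' y y' :: "'a::linorder"
  assumes "x \<noteq> x'" "x \<noteq> y'" "y \<noteq> x'" "y \<noteq> y'"
    and "if x < x' then P = b else Q = b"
    and "if y < y' then P = b else Q = b"
    and "if y < x' then P = (\<not> b) else Q = (\<not> b)"
  shows "x < x' \<and> x' < y \<and> y < y' \<or> y' < y \<and> y < x' \<and> x' < x"
  using assms by (auto split: if_splits)

lemma columns_le_letters_power:
  fixes G :: "(nat \<times> nat) ugraph"
  assumes k: "k \<ge> 2" and verts: "{0..<k} \<times> {1..l} \<subseteq> verts G"
    and edges: "\<And>i m n. i < k \<Longrightarrow> m \<in> {1..l} \<Longrightarrow> n \<in> {1..l} \<Longrightarrow>
      {(i, m), (Suc i mod k, n)} \<in> edges G \<longleftrightarrow> (m \<le> n) = b"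
    and rep: "has_letter_rep G c"
  shows "l \<le> c ^ k"
proof (rule ccontr)
  assume less: "\<not> l \<le> c ^ k"
  obtain \<Sigma> :: "nat set" and A and pos letter :: "nat \<times> nat \<Rightarrow> nat"
    where \<Sigma>: "finite \<Sigma>" "card \<Sigma> = c"
      and inj: "inj_on pos (verts G)" and letter: "letter ` verts G \<subseteq> \<Sigma>"
      and adj: "\<And>u v. u \<in> verts G \<Longrightarrow> v \<in> verts G \<Longrightarrow> pos u < pos v \<Longrightarrow>
        {u, v} \<in> edges G \<longleftrightarrow> (letter u, letter v) \<in> A"
    using rep by (elim has_letter_repE) blast
  have vert: "(i, p) \<in> verts G" if "i < k" "p \<in> {1..l}" for i p
    using verts that by auto
  define col where "col m = (\<lambda>i\<in>{0..<k}. letter (i, m))" for m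
  have "col ` {1..l} \<subseteq> {0..<k} \<rightarrow>\<^sub>E \<Sigma>"
    unfolding col_def
    by (intro image_subsetI restrict_PiE_iff[THEN iffD2] ballI subsetD[OF letter imageI] vert) simp_all
  moreover have "finite ({0..<k} \<rightarrow>\<^sub>E \<Sigma>)" "card ({0..<k} \<rightarrow>\<^sub>E \<Sigma>) = c ^ k"
    using \<Sigma> by (simp_all add: finite_PiE card_funcsetE)
  ultimately have "\<not> inj_on col {1..l}"
    using card_inj_on_le[of col "{1..l}" "{0..<k} \<rightarrow>\<^sub>E \<Sigma>"] less by auto
  then obtain m n where mn: "m < n" "m \<in> {1..l}" "n \<in> {1..l}" and col: "col m = col n"
    unfolding inj_on_def by (metis linorder_neqE_nat)
  have same: "letter (i, m) = letter (i, n)" if "i < k" for i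
    using fun_cong[OF col, of i] that by (simp add: col_def)
  define x where "x i = pos (i, m)" for i
  define y where "y i = pos (i, n)" for i
  have order: "x i < x (Suc i mod k) \<and> x (Suc i mod k) < y i \<and> y i < y (Suc i mod k) \<or>
      y (Suc i mod k) < y i \<and> y i < x (Suc i mod k) \<and> x (Suc i mod k) < x i"
    if i: "i < k" for i
  proof -
    let ?s = "Suc i mod k"
    have s: "?s < k" "?s \<noteq> i" using k i Suc_mod_neq by auto
    let ?P = "(letter (i, m), letter (?s, m)) \<in> A"
    let ?Q = "(letter (?s, m), letter (i, m)) \<in> A"
    have neq: "pos (i, p) \<noteq> pos (?s, q)" if "p \<in> {m, n}" "q \<in> {m, n}" for p q
    proof
      assume "pos (i, p) = pos (?s, q)"
      moreover have "(i, p) \<in> verts G" "(?s, q) \<in> verts G"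
        using that mn(2,3) by (auto intro: vert[OF i] vert[OF s(1)])
      ultimately have "(i, p) = (?s, q)" by (rule inj_onD[OF inj])
      then show False using s(2) by simp
    qed
    have dir: "if pos (i, p) < pos (?s, q) then ?P = ((p \<le> q) = b) else ?Q = ((p \<le> q) = b)"
      if pq: "p \<in> {m, n}" "q \<in> {m, n}" for p q
    proof -
      have v: "(i, p) \<in> verts G" "(?s, q) \<in> verts G"
        using pq mn(2,3) by (auto intro: vert[OF i] vert[OF s(1)])
      have l: "letter (i, p) = letter (i, m)" "letter (?s, q) = letter (?s, m)"
        using same i s pq by auto
      have e: "{(i, p), (?s, q)} \<in> edges G \<longleftrightarrow> (p \<le> q) = b" using edges i mn pq by auto
      show ?thesis
      proof (cases "pos (i, p) < pos (?s, q)")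
        case True
        then show ?thesis using adj[OF v] e l by simp
      next
        case False
        then have "pos (?s, q) < pos (i, p)" using neq[OF pq] by simp
        then show ?thesis using adj[OF v(2,1)] e l False by (simp add: insert_commute)
      qed
    qed
    show ?thesis
      unfolding x_def y_def
    proof (rule two_column_order[where P = ?P and Q = ?Q and b = b])
      show "if pos (i, m) < pos (?s, m) then ?P = b else ?Q = b"
        using dir[of m m] by simp
      show "if pos (i, n) < pos (?s, n) then ?P = b else ?Q = b"
        using dir[of n n] by simp
      show "if pos (i, n) < pos (?s, m) then ?P = (\<not> b) else ?Q = (\<not> b)"
        using dir[of n m] mn(1) by simp
    qed (use neq in auto)
  qed
  have uniform: "x i < y i \<longleftrightarrow> x 0 < y 0" if "i < k" for i
    using that
  proof (induction i)
    case (Suc i)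
    then show ?case using order[of i] by auto
  qed simp
  show False
  proof (cases "x 0 < y 0")
    case True
    then have "x i < x (Suc i mod k)" if "i < k" for i
      using order[OF that] uniform[OF that] by auto
    then show False using cyclic_not_strictly_monotone(1)[of k x] k by force
  next
    case False
    then have "x (Suc i mod k) < x i" if "i < k" for i
      using order[OF that] uniform[OF that] by auto
    then show False using cyclic_not_strictly_monotone(2)[of k x] k by force
  qed
qed

lemma C_graph_edge_iff:
  assumes "k \<ge> 3" "i < k" "m \<in> {1..l}" "n \<in> {1..l}"
  shows "{(i, m), (Suc i mod k, n)} \<in> edges (C_graph k l) \<longleftrightarrow> m \<le> n"
proof
  assume "{(i, m), (Suc i mod k, n)} \<in> edges (C_graph k l)"
  then obtain i' m' n' where i': "i' < k" "m' \<le> n'"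
    and eq: "{(i, m), (Suc i mod k, n)} = {(i', m'), (Suc i' mod k, n')}"
    unfolding C_graph_def by auto
  \<comment> \<open>With at least three bags, each consecutive pair of bags has only one cyclic orientation.\<close>
  have "\<not> (i = Suc i' mod k \<and> Suc i mod k = i')"
    using Suc_Suc_mod_neq[OF assms(1) i'(1)] Suc_Suc_mod_neq[OF assms(1,2)] by auto
  then have "(i, m) = (i', m') \<and> (Suc i mod k, n) = (Suc i' mod k, n')"
    using eq unfolding doubleton_eq_iff by blast
  then show "m \<le> n" using i'(2) by simp
next
  assume "m \<le> n"
  then show "{(i, m), (Suc i mod k, n)} \<in> edges (C_graph k l)"
    unfolding C_graph_def snd_conv using assms by blast
qed

lemma C_graph_in_C_class:
  assumes "l \<ge> 1"
  shows "C_graph k l \<in> C_class k"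
proof -
  have "Suc i mod k < k" if "i < k" for i using that by simp
  then have "induced_subgraph (C_graph k l) (verts (C_graph k l)) = C_graph k l"
    by (auto simp: induced_subgraph_def C_graph_def)
  then show ?thesis using assms unfolding C_class_def by force
qed

lemma complement_C_graph_edge_iff:
  assumes "k \<ge> 3" "i < k" "m \<in> {1..l}" "n \<in> {1..l}"
  shows "{(i, m), (Suc i mod k, n)} \<in> edges (chain_circuit_complement k fst (C_graph k l))
    \<longleftrightarrow> \<not> m \<le> n"
proof -
  let ?u = "(i, m)" and ?v = "(Suc i mod k, n)"
  have uv: "?u \<in> verts (C_graph k l)" "?v \<in> verts (C_graph k l)" "?u \<noteq> ?v"
    using assms Suc_mod_neq[of k i] by (auto simp: C_graph_def)
  have cons: "consecutive_bags k i (Suc i mod k)" "consecutive_bags k (Suc i mod k) i"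
    by (simp_all add: consecutive_bags_def)
  have "{?u, ?v} \<in> edges (chain_circuit_complement k fst (C_graph k l))
      \<longleftrightarrow> {?u, ?v} \<notin> edges (C_graph k l)"
  proof
    assume "{?u, ?v} \<in> edges (chain_circuit_complement k fst (C_graph k l))"
    then obtain u v where eq: "{?u, ?v} = {u, v}"
      and e: "if consecutive_bags k (fst u) (fst v) then {u, v} \<notin> edges (C_graph k l)
        else {u, v} \<in> edges (C_graph k l)"
      unfolding chain_circuit_complement_def by auto
    have "consecutive_bags k (fst u) (fst v)"
      using eq cons unfolding doubleton_eq_iff by auto
    then show "{?u, ?v} \<notin> edges (C_graph k l)" using e eq by simp
  next
    assume "{?u, ?v} \<notin> edges (C_graph k l)"
    then show "{?u, ?v} \<in> edges (chain_circuit_complement k fst (C_graph k l))"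
      unfolding chain_circuit_complement_def snd_conv using uv cons(1)
      by (intro CollectI exI[of _ ?u] exI[of _ ?v]) simp
  qed
  then show ?thesis using C_graph_edge_iff[OF assms] by simp
qed

lemma has_letter_rep_lettericity:
  assumes "simple_graph G"
  shows "has_letter_rep G (lettericity G)"
  unfolding lettericity_def using has_letter_rep_card[OF assms] by (rule LeastI)

lemma unbounded_lettericity_if_columns:
  fixes \<G> :: "(nat \<times> nat) ugraph set"
  assumes "k \<ge> 2" and "\<And>G. G \<in> \<G> \<Longrightarrow> simple_graph G"
    and "\<And>l. l \<ge> 1 \<Longrightarrow> H l \<in> \<G>" and "\<And>l. {0..<k} \<times> {1..l} \<subseteq> verts (H l)"
    and "\<And>l i m n. i < k \<Longrightarrow> m \<in> {1..l} \<Longrightarrow> n \<in> {1..l} \<Longrightarrow>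
      {(i, m), (Suc i mod k, n)} \<in> edges (H l) \<longleftrightarrow> (m \<le> n) = b"
  shows "unbounded_lettericity \<G>"
  unfolding unbounded_lettericity_def
proof
  assume "\<exists>c. \<forall>G\<in>\<G>. lettericity G \<le> c"
  then obtain c where c: "\<And>G. G \<in> \<G> \<Longrightarrow> lettericity G \<le> c" by blast
  let ?G = "H (Suc (c ^ k))"
  have G: "?G \<in> \<G>" using assms(3) by simp
  have "Suc (c ^ k) \<le> lettericity ?G ^ k"
    using columns_le_letters_power[OF assms(1,4,5) has_letter_rep_lettericity[OF assms(2)[OF G]]]
    by blast
  also have "\<dots> \<le> c ^ k" using c[OF G] by (rule power_mono) simp
  finally show False by simp
qed

theorem theorem10:
  fixes k :: nat
  assumes "k \<ge> 3"
  shows "unbounded_lettericity (C_class k) \<and> unbounded_lettericity (C_compl_class k)"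
proof
  have k2: "k \<ge> 2" using assms by simp
  show "unbounded_lettericity (C_class k)"
  proof (rule unbounded_lettericity_if_columns[OF k2 simple_graph_C_class[OF k2],
        where H = "C_graph k" and b = True])
    show "C_graph k l \<in> C_class k" if "l \<ge> 1" for l
      using that by (rule C_graph_in_C_class)
  qed (use assms C_graph_edge_iff in \<open>auto simp: C_graph_def\<close>)
  show "unbounded_lettericity (C_compl_class k)"
  proof (rule unbounded_lettericity_if_columns[OF k2 simple_graph_C_compl_class[OF k2],
        where H = "\<lambda>l. chain_circuit_complement k fst (C_graph k l)" and b = False])
    show "chain_circuit_complement k fst (C_graph k l) \<in> C_compl_class k" if "l \<ge> 1" for l
      unfolding C_compl_class_def using C_graph_in_C_class[OF that] by (rule imageI)
    show "{0..<k} \<times> {1..l} \<subseteq> verts (chain_circuit_complement k fst (C_graph k l))" for l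
      by (simp add: chain_circuit_complement_def C_graph_def)
  qed (use assms complement_C_graph_edge_iff in auto)
qed

end
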